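(* For \textsf{MAXCONNECTIVITY} on a path, the power of preemption is unbounded: there exists an instance on a path for which every non-preemptive schedule has total connectivity time $0$, while some preemptive schedule has positive total connectivity time.
   Context: An instance consists of a graph $G=(V,E)$ which is a path from $s^+$ to $s^-$, and, for every edge $e$, a maintenance job with processing time $p_e\in\mathbb{Z}_{\ge0}$, release date $r_e$ and deadline $d_e$ (nonnegative integers). A schedule assigns to each edge $e$ a finite set of disjoint intervals within $[r_e,d_e]$ of total length $p_e$ (preemptive, arbitrary real preemption) or a single such interval (non-preemptive); edge $e$ is unavailable during these intervals; arbitrarily many edges may be maintained simultaneously. Time horizon $T=\max_e d_e$. The network is connected at time $t$ if no edge of the path is maintained at $t$. \textsf{MAXCONNECTIVITY} maximizes the measure of connected times in $[0,T]$. The power of preemption is the maximum ratio of the optimal preemptive value to the optimal non-preemptive value. *)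

theory Defs
  imports "HOL-Analysis.Analysis"
begin

text \<open>Undirected graphs; an edge is the set of its two end vertices.\<close>

record 'v maint_instance =
  verts :: "'v set"
  edges :: "'v set set"
  source :: 'v
  sink :: 'v
  proc :: "'v set \<Rightarrow> nat"
  release :: "'v set \<Rightarrow> nat"
  deadline :: "'v set \<Rightarrow> nat"

text \<open>The whole graph is one simple path. The condition that the two terminals differ ensures
  that there is at least one edge, so that the time horizon is a maximum over a nonempty set.\<close>

definition path_instance :: "'v maint_instance \<Rightarrow> bool" where
  "path_instance I \<longleftrightarrow> source I \<noteq> sink I \<and>
     (\<exists>vs. vs \<noteq> [] \<and> distinct vs \<and> hd vs = source I \<and> last vs = sink I \<and>
        verts I = set vs \<and>
        edges I = {{vs ! i, vs ! Suc i} | i. Suc i < length vs})"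

definition horizon :: "'v maint_instance \<Rightarrow> nat" where
  "horizon I = Max (deadline I ` edges I)"

text \<open>A schedule maps every edge to its set of maintenance intervals. The intervals may be open,
  closed or half-open; degenerate ones are permitted (they are needed for jobs of processing time 0
  in the non-preemptive case). Values outside the edge set are irrelevant.\<close>

type_synonym 'v schedule = "'v set \<Rightarrow> real set set"

definition preemptive_schedule :: "'v maint_instance \<Rightarrow> 'v schedule \<Rightarrow> bool" where
  "preemptive_schedule I S \<longleftrightarrow> (\<forall>e\<in>edges I.
     finite (S e) \<and> disjoint (S e) \<and>
     (\<forall>J\<in>S e. is_interval J \<and> J \<subseteq> {real (release I e)..real (deadline I e)}) \<and>
     (\<Sum>J\<in>S e. measure lborel J) = real (proc I e))"

definition nonpreemptive_schedule :: "'v maint_instance \<Rightarrow> 'v schedule \<Rightarrow> bool" where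
  "nonpreemptive_schedule I S \<longleftrightarrow>
     preemptive_schedule I S \<and> (\<forall>e\<in>edges I. \<exists>J. S e = {J})"

definition connected_at :: "'v maint_instance \<Rightarrow> 'v schedule \<Rightarrow> real \<Rightarrow> bool" where
  "connected_at I S t \<longleftrightarrow> (\<forall>e\<in>edges I. t \<notin> \<Union>(S e))"

definition connectivity_time :: "'v maint_instance \<Rightarrow> 'v schedule \<Rightarrow> real" where
  "connectivity_time I S = measure lborel {t \<in> {0..real (horizon I)}. connected_at I S t}"

definition opt_preemptive :: "'v maint_instance \<Rightarrow> ennreal" where
  "opt_preemptive I = (SUP S\<in>{S. preemptive_schedule I S}. ennreal (connectivity_time I S))"

definition opt_nonpreemptive :: "'v maint_instance \<Rightarrow> ennreal" where
  "opt_nonpreemptive I = (SUP S\<in>{S. nonpreemptive_schedule I S}. ennreal (connectivity_time I S))"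

text \<open>In \<^typ>\<open>ennreal\<close>, a positive value divided by 0 is \<^term>\<open>top :: ennreal\<close>, whereas 0 / 0 = 0, so instances whose two
  optima are both 0 (in particular those without any feasible schedule) do not contribute to
  the supremum. Naming the vertices by natural numbers loses no finite path.\<close>

definition power_of_preemption :: ennreal where
  "power_of_preemption =
     (SUP I\<in>{I :: nat maint_instance. path_instance I}. opt_preemptive I / opt_nonpreemptive I)"

end

theory Submission imports Defs begin

text \<open>Two rigid jobs block \<open>[0,1]\<close> and \<open>[2,3]\<close>; a third job of length 2 with window \<open>[0,3]\<close> can be hidden
  behind them when preempted, but as a single interval it always covers \<open>(1,2)\<close>.\<close>

definition gap_instance :: "nat maint_instance" where
  "gap_instance = \<lparr>verts = {0,1,2,3}, edges = {{0,1},{1,2},{2,3}}, source = 0, sink = 3,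
     proc = (\<lambda>e. if 0 \<in> e \<or> 3 \<in> e then 1 else 2),
     release = (\<lambda>e. if 3 \<in> e then 2 else 0),
     deadline = (\<lambda>e. if 0 \<in> e then 1 else 3)\<rparr>"

text \<open>Vertices 0 and 3 each lie on one end edge only, so membership tests tell the three edges
  apart.\<close>

definition gap_schedule :: "nat schedule" where
  "gap_schedule e = (if 0 \<in> e then {{0..1}} else if 3 \<in> e then {{2..3}} else {{0..1},{2..3}})"

text \<open>An interval missing \<open>t\<close> lies on one side of \<open>t\<close>, inside
  \<open>{a..t}\<close> or \<open>{t..b}\<close>, and both are shorter than
  \<open>p\<close>.\<close>

lemma interval_in_window_covers_middle:
  fixes J :: "real set"
  assumes J: "is_interval J" "J \<subseteq> {a..b}" and p: "measure lborel J = p" "0 < p"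
    and t: "b - p < t" "t < a + p"
  shows "t \<in> J"
proof (rule ccontr)
  assume "t \<notin> J"
  have "J \<noteq> {}" using p by auto
  \<comment> \<open>Nonemptiness of \<open>J\<close> gives \<open>u \<le> v\<close>, so that
    \<open>{u..v}\<close> really has measure \<open>v - u\<close>.\<close>
  have bound: "p \<le> v - u" if "J \<subseteq> {u..v}" for u v
  proof -
    have "u \<le> v" using that \<open>J \<noteq> {}\<close> by fastforce
    then show ?thesis
      using measure_mono_fmeasurable[of J "{u..v}" lborel] that p
        real_interval_borel_measurable[OF J(1)]
      by (simp add: fmeasurable_def)
  qed
  from \<open>t \<notin> J\<close> J(1) have "(\<forall>x\<in>J. x \<le> t) \<or> (\<forall>x\<in>J. t \<le> x)"
    unfolding is_interval_1 by (meson linear)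
  then have "J \<subseteq> {a..t} \<or> J \<subseteq> {t..b}" using J(2) by auto
  then show False using bound t by fastforce
qed

text \<open>This is the compulsory part of a job: the times between its latest start and its
  earliest completion. For a rigid job it is the whole open window.\<close>

lemma nonpreemptive_covers_middle:
  assumes S: "nonpreemptive_schedule I S" and e: "e \<in> edges I" "0 < proc I e"
    and t: "real (deadline I e) - real (proc I e) < t" "t < real (release I e) + real (proc I e)"
  shows "\<not> connected_at I S t"
proof -
  obtain J where J: "S e = {J}" using S e unfolding nonpreemptive_schedule_def by blast
  have "is_interval J" "J \<subseteq> {real (release I e)..real (deadline I e)}"
    "measure lborel J = real (proc I e)"
    using S e J unfolding nonpreemptive_schedule_def preemptive_schedule_def by force+
  then have "t \<in> J" using interval_in_window_covers_middle t e(2) by simp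
  then show ?thesis using e J unfolding connected_at_def by auto
qed

lemma path_instance_gap_instance: "path_instance gap_instance"
proof -
  let ?vs = "[0, 1, 2, 3 :: nat]"
  \<comment> \<open>An explicit index set turns the edge comprehension into a finite image that
    simplification can evaluate.\<close>
  have "{i. Suc i < length ?vs} = {0,1,2}" by auto
  then have "{{?vs ! i, ?vs ! Suc i} | i. Suc i < length ?vs} =
      (\<lambda>i. {?vs ! i, ?vs ! Suc i}) ` {0,1,2}" by blast
  also have "\<dots> = edges gap_instance" by (simp add: gap_instance_def numeral_eq_Suc)
  finally have "edges gap_instance = {{?vs ! i, ?vs ! Suc i} | i. Suc i < length ?vs}" ..
  moreover have "source gap_instance \<noteq> sink gap_instance" "?vs \<noteq> []" "distinct ?vs"
    "hd ?vs = source gap_instance" "last ?vs = sink gap_instance" "verts gap_instance = set ?vs"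
    by (simp_all add: gap_instance_def)
  ultimately show ?thesis unfolding path_instance_def by blast
qed

lemma horizon_gap_instance: "horizon gap_instance = 3"
  by (simp add: horizon_def gap_instance_def)

text \<open>The compulsory parts of the three jobs are \<open>(0,1)\<close>, \<open>(1,2)\<close>
  and \<open>(2,3)\<close>; together they leave only four points of \<open>[0,3]\<close>, a null
  set.\<close>

lemma connectivity_time_nonpreemptive_gap_instance:
  assumes "nonpreemptive_schedule gap_instance S"
  shows "connectivity_time gap_instance S = 0"
proof -
  note cover = nonpreemptive_covers_middle[OF assms]
  have left: "\<not> connected_at gap_instance S t" if "0 < t" "t < 1" for t
    using cover[of "{0,1}" t] that by (simp add: gap_instance_def)
  have middle: "\<not> connected_at gap_instance S t" if "1 < t" "t < 2" for t
    using cover[of "{1,2}" t] that by (simp add: gap_instance_def)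
  have right: "\<not> connected_at gap_instance S t" if "2 < t" "t < 3" for t
    using cover[of "{2,3}" t] that by (simp add: gap_instance_def)
  have "{t \<in> {0..3}. connected_at gap_instance S t} \<subseteq> {0,1,2,3}"
  proof
    fix t assume t: "t \<in> {t \<in> {0..3}. connected_at gap_instance S t}"
    then have "\<not> (0 < t \<and> t < 1)" "\<not> (1 < t \<and> t < 2)" "\<not> (2 < t \<and> t < 3)"
      using left middle right by blast+
    moreover have "0 \<le> t" "t \<le> 3" using t by auto
    ultimately have "t = 0 \<or> t = 1 \<or> t = 2 \<or> t = 3" by linarith
    then show "t \<in> {0,1,2,3}" by simp
  qed
  then have "finite {t \<in> {0..3}. connected_at gap_instance S t}"
    by (rule finite_subset) simp
  then show ?thesis
    unfolding connectivity_time_def horizon_gap_instance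
    by (simp add: finite_imp_null_set_lborel measure_eq_0_null_sets)
qed

lemma preemptive_schedule_gap_schedule: "preemptive_schedule gap_instance gap_schedule"
proof -
  \<comment> \<open>The two pieces of the inner job must be distinct sets for the sum over them to
    be 2 rather than 1.\<close>
  have "{0..1::real} \<noteq> {2..3}" by (simp add: Icc_eq_Icc)
  moreover have "{0..1} \<inter> {2..3::real} = {}" "{2..3} \<inter> {0..1::real} = {}" by auto
  ultimately show ?thesis
    by (simp add: preemptive_schedule_def gap_instance_def gap_schedule_def
        disjoint_def is_interval_cc)
qed

lemma connectivity_time_gap_schedule: "connectivity_time gap_instance gap_schedule = 1"
proof -
  have "{t \<in> {0..3}. connected_at gap_instance gap_schedule t} = {1<..<2}"
    by (auto simp: connected_at_def gap_instance_def gap_schedule_def)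
  then show ?thesis by (simp add: connectivity_time_def horizon_gap_instance)
qed

theorem theorem8:
  "power_of_preemption = top \<and>
   (\<exists>I :: nat maint_instance. path_instance I \<and>
      (\<forall>S. nonpreemptive_schedule I S \<longrightarrow> connectivity_time I S = 0) \<and>
      (\<exists>S. preemptive_schedule I S \<and> connectivity_time I S > 0))"
proof
  have non: "opt_nonpreemptive gap_instance = 0"
    \<comment> \<open>Written as \<open>bot\<close>, the value 0 of the supremum means that every
      term is 0.\<close>
    unfolding opt_nonpreemptive_def bot_ennreal[symmetric] SUP_bot_conv
    by (simp add: bot_ennreal connectivity_time_nonpreemptive_gap_instance)
  have "ennreal 1 \<le> opt_preemptive gap_instance"
    unfolding opt_preemptive_def connectivity_time_gap_schedule[symmetric]
    by (rule SUP_upper) (simp add: preemptive_schedule_gap_schedule)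
  then have "opt_preemptive gap_instance \<noteq> 0" by auto
  \<comment> \<open>A nonzero value over 0 is \<open>top\<close> in \<open>ennreal\<close>, so this
    one instance already forces the supremum to be \<open>top\<close>.\<close>
  then have "opt_preemptive gap_instance / opt_nonpreemptive gap_instance = top"
    by (simp add: non)
  then have "top \<le> power_of_preemption"
    unfolding power_of_preemption_def
    by (metis (mono_tags, lifting) SUP_upper mem_Collect_eq path_instance_gap_instance)
  then show "power_of_preemption = top" by (simp add: top_unique)
next
  show "\<exists>I :: nat maint_instance. path_instance I \<and>
      (\<forall>S. nonpreemptive_schedule I S \<longrightarrow> connectivity_time I S = 0) \<and>
      (\<exists>S. preemptive_schedule I S \<and> connectivity_time I S > 0)"
    using path_instance_gap_instance connectivity_time_nonpreemptive_gap_instance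
      preemptive_schedule_gap_schedule connectivity_time_gap_schedule
    by (metis zero_less_one)
qed

end
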